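(* Let $\alpha,\beta>-1$, let $n\ge 1$ be an integer and let $\theta>0$. Let $H_\theta^{(n+1)}$ be the $(n+1)$-point modified anti-Gaussian rule with parameter $\theta$ for the Jacobi weight $w_{\alpha,\beta}(x)=(1-x)^\alpha(1+x)^\beta$ on $(-1,1)$. Define $$h(n,x,y)=1+\frac{(2x+1)\,n\,(n+x+y+1)+\frac12(x+1)(x+y)(x+y+1)}{n\,(n+y)\left(n+\frac{x+y}{2}+1\right)}$$ and $$\theta_{\max}(n,\alpha,\beta)=\min\{h(n,\alpha,\beta),\,h(n,\beta,\alpha)\}.$$ Then $H_\theta^{(n+1)}$ is internal if and only if $\theta\le\theta_{\max}(n,\alpha,\beta)$.
   Context: Let $I(f)=\int_{-1}^1 f(x)w_{\alpha,\beta}(x)\,dx$, and let $G^{(n)}$ be the $n$-point Gaussian quadrature rule for $I$. Write $\mathbb{P}_{m}$ for the polynomials of degree at most $m$. The modified anti-Gaussian rule with parameter $\theta>0$ is the $(n+1)$-point quadrature rule $H_\theta^{(n+1)}(f)=\sum_{k=1}^{n+1}\lambda_k f(\xi_k)$, $\xi_1<\dots<\xi_{n+1}$, satisfying $$H_\theta^{(n+1)}(p)=(1+\theta)I(p)-\theta G^{(n)}(p)\quad\text{for all }p\in\mathbb{P}_{2n+1};$$ equivalently, it is the $(n+1)$-point Gaussian rule for the linear functional $(1+\theta)I-\theta G^{(n)}$. Its nodes are real. The rule is called internal if all its nodes lie in $[-1,1]$. *)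

theory Defs
  imports "HOL-Analysis.Analysis" "HOL-Computational_Algebra.Polynomial"
begin

text \<open>The Jacobi weight on the open interval from \<open>-1\<close> to \<open>1\<close>. At the two end points the value
  is \<open>0\<close> by the convention \<open>0 powr a = 0\<close>, which does not affect integrals.\<close>

definition jacobi_weight :: "real \<Rightarrow> real \<Rightarrow> real \<Rightarrow> real" where
  "jacobi_weight \<alpha> \<beta> x = (1 - x) powr \<alpha> * (1 + x) powr \<beta>"

definition jacobi_integral :: "real \<Rightarrow> real \<Rightarrow> (real \<Rightarrow> real) \<Rightarrow> real" where
  "jacobi_integral \<alpha> \<beta> f = integral {-1..1} (\<lambda>x. f x * jacobi_weight \<alpha> \<beta> x)"

text \<open>An \<open>m\<close>-point rule is given by weights \<open>c\<close> and nodes \<open>x\<close>, both indexed by \<open>1, \<dots>, m\<close>;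
  the values of \<open>c\<close> and \<open>x\<close> at other indices are irrelevant.\<close>

definition quad_rule :: "nat \<Rightarrow> (nat \<Rightarrow> real) \<Rightarrow> (nat \<Rightarrow> real) \<Rightarrow> (real \<Rightarrow> real) \<Rightarrow> real" where
  "quad_rule m c x f = (\<Sum>k=1..m. c k * f (x k))"

text \<open>The \<open>m\<close>-point Gaussian rule for a functional \<open>L\<close>: exactness on polynomials of degree at
  most \<open>2 * m - 1\<close> (written with a strict inequality, so that no truncated subtraction occurs).\<close>

definition is_gauss_rule ::
  "((real \<Rightarrow> real) \<Rightarrow> real) \<Rightarrow> nat \<Rightarrow> (nat \<Rightarrow> real) \<Rightarrow> (nat \<Rightarrow> real) \<Rightarrow> bool" where
  "is_gauss_rule L m c x \<longleftrightarrow>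
     strict_mono_on {1..m} x \<and>
     (\<forall>p :: real poly. degree p < 2 * m \<longrightarrow> quad_rule m c x (poly p) = L (poly p))"

text \<open>The modified anti-Gaussian rule for the functional \<open>I\<close>, relative to the \<open>n\<close>-point
  Gaussian rule \<open>G\<close> for \<open>I\<close>.\<close>

definition is_modified_anti_gauss_rule ::
  "((real \<Rightarrow> real) \<Rightarrow> real) \<Rightarrow> ((real \<Rightarrow> real) \<Rightarrow> real) \<Rightarrow> real \<Rightarrow> nat
    \<Rightarrow> (nat \<Rightarrow> real) \<Rightarrow> (nat \<Rightarrow> real) \<Rightarrow> bool" where
  "is_modified_anti_gauss_rule I G \<theta> n c \<xi> \<longleftrightarrow>
     strict_mono_on {1..n+1} \<xi> \<and>
     (\<forall>p :: real poly. degree p \<le> 2 * n + 1 \<longrightarrow>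
        quad_rule (n + 1) c \<xi> (poly p) = (1 + \<theta>) * I (poly p) - \<theta> * G (poly p))"

definition internal_rule :: "nat \<Rightarrow> (nat \<Rightarrow> real) \<Rightarrow> bool" where
  "internal_rule m x \<longleftrightarrow> (\<forall>k\<in>{1..m}. x k \<in> {-1..1})"

definition h_bound :: "nat \<Rightarrow> real \<Rightarrow> real \<Rightarrow> real" where
  "h_bound n x y =
     1 + ((2 * x + 1) * real n * (real n + x + y + 1) + 1 / 2 * (x + 1) * (x + y) * (x + y + 1))
         / (real n * (real n + y) * (real n + (x + y) / 2 + 1))"

definition theta_max :: "nat \<Rightarrow> real \<Rightarrow> real \<Rightarrow> real" where
  "theta_max n \<alpha> \<beta> = min (h_bound n \<alpha> \<beta>) (h_bound n \<beta> \<alpha>)"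

end

theory Submission
  imports Defs
begin

text \<open>
  Write \<open>P\<close> and \<open>W\<close> for the monic polynomials whose roots are the nodes of the Gaussian and of
  the modified anti-Gaussian rule. Since all but the largest anti-Gaussian node lie strictly to the
  left of \<open>1\<close>, the rule is internal at the right end exactly when \<open>W(1) \<ge> 0\<close>; the left end follows
  by the reflection \<open>x \<mapsto> -x\<close>, which exchanges \<open>\<alpha>\<close> and \<open>\<beta>\<close>. This is why \<open>theta_max\<close> is a
  minimum of two values of the same function.

  To find the sign of \<open>W(1)\<close>, observe that the functional \<open>(1 + \<theta>) I - \<theta> G\<close> agrees with \<open>I\<close> in
  low degrees and with \<open>(1 + \<theta>) I\<close> on multiples of \<open>P\<close>. In the three-term recurrence that produces
  \<open>W\<close>, only the last coefficient is therefore multiplied by \<open>1 + \<theta>\<close>: \<open>W = U - \<theta> V\<close>, where \<open>U\<close> is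
  the monic orthogonal polynomial of degree \<open>n + 1\<close> and \<open>U + V = (x - a) P\<close>
  (\<open>modified_nodal_decomposition\<close>). The structure relation
  \<open>(1 - x^2) P' = - n U + b P + (n + \<alpha> + \<beta> + 1) V\<close> degenerates at \<open>x = 1\<close> to a second linear
  equation between \<open>U(1)\<close>, \<open>V(1)\<close> and \<open>P(1) > 0\<close>, and \<open>a\<close> and \<open>b\<close> depend only on the subleading
  coefficients of \<open>P\<close> and \<open>U\<close>, which can be read off from the
  Jacobi differential equation. Solving the two equations (\<open>values_at_one\<close>) gives \<open>V(1) > 0\<close> and
  \<open>U(1) = h(n, \<alpha>, \<beta>) V(1)\<close>, hence \<open>W(1) = (h(n, \<alpha>, \<beta>) - \<theta>) V(1)\<close>.

  All identities for orthogonal polynomials are consequences of two properties of the functional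
  \<open>I\<close>: positivity, and the relation (due to Pearson) obtained by integrating the derivative of
  \<open>(1 - x^2) w(x) p(x)\<close> over the interval.
\<close>

section \<open>The Jacobi integral on polynomials\<close>

text \<open>
  The affine map of the interval to \<open>[0, 1]\<close> turns the weight into the integrand of the Beta function.
\<close>

lemma jacobi_weight_integrable:
  assumes "\<alpha> > -1" and "\<beta> > -1"
  shows "jacobi_weight \<alpha> \<beta> absolutely_integrable_on {-1..1}"
proof (rule nonnegative_absolutely_integrable_1)
  have "(\<lambda>t. t powr (\<beta> + 1 - 1) * (1 - t) powr (\<alpha> + 1 - 1)) integrable_on cbox 0 1"
    using has_integral_Beta_real[of "\<beta> + 1" "\<alpha> + 1"] assms
    by (auto simp: integrable_on_def)
  from integrable_affinity[OF this, of "1/2" "1/2"]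
  have "(\<lambda>x. ((1 + x) / 2) powr \<beta> * ((1 - x) / 2) powr \<alpha>) integrable_on ((\<lambda>x. 2 * x - 1) ` {0..1})"
    by (simp add: field_simps)
  moreover have "(\<lambda>x::real. 2 * x - 1) ` {0..1} = {-1..1}"
    using image_affinity_atLeastAtMost[of 2 "-1" 0 "1::real"] by simp
  ultimately have "(\<lambda>x. 2 powr (\<alpha> + \<beta>) * (((1 + x) / 2) powr \<beta> * ((1 - x) / 2) powr \<alpha>)) integrable_on {-1..1}"
    by (simp add: integrable_on_mult_right)
  then show "jacobi_weight \<alpha> \<beta> integrable_on {-1..1}"
    by (rule integrable_eq) (auto simp: jacobi_weight_def powr_divide powr_add)
qed (simp add: jacobi_weight_def)

lemma poly_jacobi_weight_integrable:
  assumes "\<alpha> > -1" and "\<beta> > -1"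
  shows "(\<lambda>x. poly p x * jacobi_weight \<alpha> \<beta> x) integrable_on {-1..1}"
proof -
  have "(\<lambda>x. poly p x * jacobi_weight \<alpha> \<beta> x) absolutely_integrable_on {-1..1}"
  proof (rule absolutely_integrable_bounded_measurable_product_real)
    show "poly p \<in> borel_measurable (lebesgue_on {-1..1})"
      by (intro continuous_imp_measurable_on_sets_lebesgue continuous_intros) auto
    show "bounded (poly p ` {-1..1})"
      by (intro compact_imp_bounded compact_continuous_image continuous_intros) auto
  qed (use assms jacobi_weight_integrable in auto)
  then show ?thesis by (simp add: set_lebesgue_integral_eq_integral)
qed

text \<open>
  A polynomial vanishing on an interval is zero; \<open>[-1/2, 1/2]\<close> serves because the weight is
  continuous and positive there, whereas it may be unbounded at \<open>-1\<close> and \<open>1\<close>.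
\<close>

lemma jacobi_integral_positive:
  fixes p :: "real poly"
  assumes "\<alpha> > -1" and "\<beta> > -1" and "p \<noteq> 0" and nonneg: "\<And>x. \<lbrakk>-1 \<le> x; x \<le> 1\<rbrakk> \<Longrightarrow> poly p x \<ge> 0"
  shows "jacobi_integral \<alpha> \<beta> (poly p) > 0"
proof -
  define f where "f = (\<lambda>x. poly p x * jacobi_weight \<alpha> \<beta> x)"
  have int: "f integrable_on {-1..1}"
    unfolding f_def using assms poly_jacobi_weight_integrable by blast
  have f0: "f x \<ge> 0" if "x \<in> {-1..1}" for x
    using nonneg that by (auto simp: f_def jacobi_weight_def)
  have cont: "continuous_on {-1/2..1/2} f"
    unfolding f_def jacobi_weight_def by (intro continuous_intros continuous_on_powr') auto
  have "integral {-1/2..1/2} f \<le> integral {-1..1} f"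
    using f0 by (intro integral_subset_le int integrable_continuous_real cont) auto
  moreover have "integral {-1/2..1/2} f \<noteq> 0"
  proof
    assume "integral {-1/2..1/2} f = 0"
    then have "(f has_integral 0) (cbox (-1/2) (1/2))"
      using integrable_integral[OF integrable_continuous_real[OF cont]] by simp
    then have *: "f x = 0" if "x \<in> {-1/2..1/2}" for x
      using has_integral_0_cbox_imp_0[of "-1/2" "1/2" f x] cont f0 that by auto
    have "{-1/2..1/2} \<subseteq> {x. poly p x = 0}"
    proof
      fix x :: real assume x: "x \<in> {-1/2..1/2}"
      then have "jacobi_weight \<alpha> \<beta> x \<noteq> 0" by (auto simp: jacobi_weight_def)
      with *[OF x] show "x \<in> {x. poly p x = 0}" by (simp add: f_def)
    qed
    then have "finite {-1/2..1/2::real}"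
      using poly_roots_finite[OF \<open>p \<noteq> 0\<close>] finite_subset by blast
    then show False using infinite_Icc[of "-1/2" "1/2::real"] by simp
  qed
  moreover have "integral {-1/2..1/2} f \<ge> 0"
    using f0 by (intro integral_nonneg integrable_continuous_real cont) auto
  ultimately show ?thesis by (simp add: jacobi_integral_def f_def)
qed

text \<open>
  The integrand is the derivative of \<open>(1 - x) powr (\<alpha> + 1) * (1 + x) powr (\<beta> + 1) * p(x)\<close>, which
  vanishes at both end points.
\<close>

lemma jacobi_integral_Pearson:
  fixes p :: "real poly"
  assumes "\<alpha> > -1" and "\<beta> > -1"
  shows "jacobi_integral \<alpha> \<beta>
           (poly ([:1, 0, -1:] * pderiv p + [:\<beta> - \<alpha>, -(\<alpha> + \<beta> + 2):] * p)) = 0"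
proof -
  define F where "F = (\<lambda>x. (1 - x) powr (\<alpha> + 1) * (1 + x) powr (\<beta> + 1) * poly p x)"
  define f where "f = (\<lambda>x. poly ([:1, 0, -1:] * pderiv p + [:\<beta> - \<alpha>, -(\<alpha> + \<beta> + 2):] * p) x
                           * jacobi_weight \<alpha> \<beta> x)"
  have "(f has_integral (F 1 - F (-1))) {-1..1}"
  proof (rule fundamental_theorem_of_calculus_interior)
    show "continuous_on {-1..1} F"
      unfolding F_def using assms by (intro continuous_intros continuous_on_powr') auto
    fix x :: real assume x: "x \<in> {-1<..<1}"
    have 1: "((\<lambda>x. (1 - x) powr (\<alpha> + 1)) has_real_derivative -(\<alpha> + 1) * (1 - x) powr \<alpha>) (at x)"
      using x by (auto intro!: derivative_eq_intros simp: algebra_simps)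
    have 2: "((\<lambda>x. (1 + x) powr (\<beta> + 1)) has_real_derivative (\<beta> + 1) * (1 + x) powr \<beta>) (at x)"
      using x by (auto intro!: derivative_eq_intros simp: algebra_simps)
    have 3: "(1 - x) powr (\<alpha> + 1) = (1 - x) * (1 - x) powr \<alpha>"
            "(1 + x) powr (\<beta> + 1) = (1 + x) * (1 + x) powr \<beta>"
      using x by (auto simp: powr_add)
    have "(F has_real_derivative f x) (at x)"
      unfolding F_def f_def jacobi_weight_def
      by (rule DERIV_cong[OF DERIV_mult[OF DERIV_mult[OF 1 2] poly_DERIV]])
         (simp only: 3, simp add: algebra_simps)
    then show "(F has_vector_derivative f x) (at x)"
      by (simp add: has_real_derivative_iff_has_vector_derivative)
  qed simp
  then show ?thesis
    by (simp add: jacobi_integral_def f_def F_def integral_unique)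
qed

lemma jacobi_integral_reflect:
  "jacobi_integral \<beta> \<alpha> (\<lambda>x. f (-x)) = jacobi_integral \<alpha> \<beta> f"
  using Henstock_Kurzweil_Integration.integral_reflect_real[of 1 "-1" "\<lambda>x. f x * jacobi_weight \<alpha> \<beta> x"]
  by (simp add: jacobi_integral_def jacobi_weight_def mult_ac)

section \<open>Orthogonal polynomials of a Jacobi functional\<close>

text \<open>
  Used to bound degrees and to identify leading coefficients after multiplication by \<open>1 - x^2\<close>.
\<close>

lemma coeff_sigma_pderiv:
  fixes q :: "real poly"
  shows "coeff ([:1, 0, -1:] * pderiv q) (Suc i) = (real i + 2) * coeff q (i + 2) - real i * coeff q i"
  by (cases i) (auto simp: coeff_pCons coeff_pderiv algebra_simps split: nat.splits)

lemma degree_less_SucI: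
  assumes "\<And>i. i \<ge> m \<Longrightarrow> coeff p (Suc i) = 0"
  shows "degree p < Suc m"
  using assms by (intro degree_lessI) (auto, metis Suc_le_D Suc_le_mono)

text \<open>
  These properties determine the Jacobi functional up to a positive factor, and every identity for
  its orthogonal polynomials can be derived from them.
\<close>

locale jacobi_functional =
  fixes I :: "real poly \<Rightarrow> real" and \<alpha> \<beta> :: real
  assumes alpha: "\<alpha> > -1" and beta: "\<beta> > -1"
    and I_add: "I (p + q) = I p + I q"
    and I_smult: "I (smult a p) = a * I p"
    and I_positive: "\<lbrakk>p \<noteq> 0; \<And>x. \<lbrakk>-1 \<le> x; x \<le> 1\<rbrakk> \<Longrightarrow> poly p x \<ge> 0\<rbrakk> \<Longrightarrow> I p > 0"
    and I_Pearson: "I ([:1, 0, -1:] * pderiv p + [:\<beta> - \<alpha>, -(\<alpha> + \<beta> + 2):] * p) = 0"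
begin

lemma I_zero: "I 0 = 0"
  using I_smult[of 0 0] by simp

lemma I_minus: "I (- p) = - I p"
  using I_smult[of "-1" p] by simp

lemma I_diff: "I (p - q) = I p - I q"
  using I_add[of p "-q"] by (simp add: I_minus)

lemmas I_linear = I_zero I_minus I_add I_diff I_smult

lemma I_square_pos: "p \<noteq> 0 \<Longrightarrow> I (p * p) > 0"
  by (rule I_positive) auto

lemma orthogonal_imp_zero:
  assumes "degree p < m" and "\<And>q. degree q < m \<Longrightarrow> I (p * q) = 0"
  shows "p = 0"
  using assms I_square_pos[of p] by fastforce

definition monic_orthogonal :: "nat \<Rightarrow> real poly \<Rightarrow> bool" where
  "monic_orthogonal m p \<longleftrightarrow>
     degree p = m \<and> lead_coeff p = 1 \<and> (\<forall>q. degree q < m \<longrightarrow> I (p * q) = 0)"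

text \<open>
  Integration by parts: the adjoint of \<open>(1 - x^2) d/dx\<close> is a first-order operator of the same shape.
\<close>

lemma I_Pearson_mult:
  "I ([:1, 0, -1:] * pderiv p * q) =
     - I (p * ([:1, 0, -1:] * pderiv q + [:\<beta> - \<alpha>, -(\<alpha> + \<beta> + 2):] * q))"
proof -
  have eq: "A * pderiv (p * q) + B * (p * q) = A * pderiv p * q + p * (A * pderiv q + B * q)" for A B
    by (simp add: pderiv_mult algebra_simps)
  show ?thesis
    using I_Pearson[of "p * q"] unfolding eq I_add by linarith
qed

text \<open>
  The second-order operator of the Jacobi differential equation. It maps polynomials of degree at
  most \<open>m\<close> to such polynomials and is symmetric for \<open>I\<close>, so orthogonal polynomials are its
  eigenfunctions.
\<close>

definition jacobi_operator :: "real poly \<Rightarrow> real poly" where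
  "jacobi_operator p =
     [:1, 0, -1:] * pderiv (pderiv p) + [:\<beta> - \<alpha>, -(\<alpha> + \<beta> + 2):] * pderiv p"

text \<open>
  Two integrations by parts bring both sides to the form \<open>- I ((1 - x^2) p' q')\<close>, which is
  symmetric in \<open>p\<close> and \<open>q\<close>.
\<close>

lemma jacobi_operator_symmetric: "I (jacobi_operator p * q) = I (p * jacobi_operator q)"
proof -
  define A B where "A = [:1, 0, -1 :: real:]" and "B = [:\<beta> - \<alpha>, -(\<alpha> + \<beta> + 2):]"
  have eq: "(A * pderiv (pderiv p) + B * pderiv p) * q
          = A * pderiv (pderiv p) * q + pderiv p * (B * q)"
    by (simp add: algebra_simps)
  have 1: "I ((A * pderiv (pderiv p) + B * pderiv p) * q) = - I (A * pderiv p * pderiv q)"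
    using I_Pearson_mult[of "pderiv p" q] unfolding A_def[symmetric] B_def[symmetric]
    unfolding eq I_add distrib_left by (simp add: mult_ac)
  have "I (p * (A * pderiv (pderiv q) + B * pderiv q)) = - I (A * pderiv p * pderiv q)"
    using I_Pearson_mult[of p "pderiv q"] unfolding A_def[symmetric] B_def[symmetric] by simp
  with 1 show ?thesis
    unfolding jacobi_operator_def A_def[symmetric] B_def[symmetric] by simp
qed

lemma coeff_jacobi_operator:
  "coeff (jacobi_operator p) i =
     (real i + 1) * (real i + 2) * coeff p (i + 2) + (\<beta> - \<alpha>) * (real i + 1) * coeff p (i + 1)
     - real i * (real i + \<alpha> + \<beta> + 1) * coeff p i"
proof -
  have 1: "coeff ([:1, 0, -1:] * pderiv (pderiv p)) i =
      (real i + 1) * (real i + 2) * coeff p (i + 2) - real i * (real i - 1) * coeff p i"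
    by (cases i; cases "i - 1") (auto simp: coeff_pCons coeff_pderiv algebra_simps split: nat.splits)
  have 2: "coeff ([:b, c:] * pderiv p) i = b * (real i + 1) * coeff p (i + 1) + c * real i * coeff p i" for b c
    by (cases i) (auto simp: coeff_pCons coeff_pderiv algebra_simps)
  show ?thesis
    unfolding jacobi_operator_def coeff_add 1 2 by (simp add: algebra_simps)
qed

lemma degree_jacobi_operator_le: "degree (jacobi_operator p) \<le> degree p"
  by (rule degree_le) (auto simp: coeff_jacobi_operator coeff_eq_0)

text \<open>
  The polynomial is an eigenfunction of the Jacobi operator, with eigenvalue \<open>- e\<close> forced by the
  leading coefficient; the claim is the eigenvalue equation at the next coefficient.
\<close>

lemma monic_orthogonal_subleading:
  assumes "monic_orthogonal (Suc m) p"
  shows "(2 * real m + \<alpha> + \<beta> + 2) * coeff p m = (real m + 1) * (\<alpha> - \<beta>)"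
proof -
  define e where "e = (real m + 1) * (real m + \<alpha> + \<beta> + 2)"
  define r where "r = jacobi_operator p + smult e p"
  have deg: "degree p = Suc m" and lead: "coeff p (Suc m) = 1"
    and orth: "\<And>q. degree q < Suc m \<Longrightarrow> I (p * q) = 0"
    using assms by (auto simp: monic_orthogonal_def)
  have "r = 0"
  proof (rule orthogonal_imp_zero)
    have "coeff r i = 0" if "i \<ge> Suc m" for i
    proof (cases "i = Suc m")
      case True
      then show ?thesis
        by (simp add: r_def coeff_jacobi_operator coeff_eq_0 deg lead e_def algebra_simps)
    next
      case False
      with that show ?thesis by (simp add: r_def coeff_jacobi_operator coeff_eq_0 deg)
    qed
    then show "degree r < Suc m" by (intro degree_lessI) auto
    fix q :: "real poly" assume q: "degree q < Suc m"
    have "I (r * q) = I (p * jacobi_operator q) + e * I (p * q)"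
      by (simp add: r_def distrib_right I_linear jacobi_operator_symmetric)
    moreover have "degree (jacobi_operator q) < Suc m"
      using q degree_jacobi_operator_le[of q] by linarith
    ultimately show "I (r * q) = 0" using q by (simp add: orth)
  qed
  then have "coeff r m = 0" by simp
  then show ?thesis
    by (simp add: r_def coeff_jacobi_operator coeff_eq_0 deg lead e_def algebra_simps)
qed

text \<open>
  The number in front of \<open>P\<close> is chosen such that the difference \<open>T\<close> of the two sides has degree at
  most \<open>m\<close>. To see that \<open>T\<close> is orthogonal to every \<open>q\<close> of degree at most \<open>m\<close>, integrate
  \<open>(1 - x^2) P' q\<close> by parts. The result is \<open>(m + \<alpha> + \<beta> + 2) I (x P q)\<close>, since the remaining terms are
  multiples of \<open>P\<close> by polynomials of degree at most \<open>m\<close>; and \<open>I (x P q) = I (V q)\<close> because \<open>U\<close> and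
  \<open>P\<close> are orthogonal to \<open>q\<close>.
\<close>

lemma structure_relation:
  assumes P: "monic_orthogonal (Suc m) P" and U: "monic_orthogonal (Suc (Suc m)) U"
    and UV: "U + V = [:-a, 1:] * P" and V: "degree V \<le> m"
  shows "[:1, 0, -1:] * pderiv P + smult (real m + 1) U =
         smult ((real m + 1) * coeff U (Suc m) - real m * coeff P m) P
         + smult (real m + \<alpha> + \<beta> + 2) V"
proof -
  define A B where "A = [:1, 0, -1 :: real:]" and "B = [:\<beta> - \<alpha>, -(\<alpha> + \<beta> + 2):]"
  define k where "k = real m + \<alpha> + \<beta> + 2"
  define b where "b = (real m + 1) * coeff U (Suc m) - real m * coeff P m"
  define T where "T = A * pderiv P + smult (real m + 1) U - smult b P - smult k V"
  have degP: "degree P = Suc m" and leadP: "coeff P (Suc m) = 1"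
    and orthP: "\<And>q. degree q < Suc m \<Longrightarrow> I (P * q) = 0"
    using P by (auto simp: monic_orthogonal_def)
  have degU: "degree U = Suc (Suc m)" and leadU: "coeff U (Suc (Suc m)) = 1"
    and orthU: "\<And>q. degree q < Suc (Suc m) \<Longrightarrow> I (U * q) = 0"
    using U by (auto simp: monic_orthogonal_def)
  have "T = 0"
  proof (rule orthogonal_imp_zero)
    have "coeff T (Suc i) = 0" if "i \<ge> m" for i
    proof -
      have "i = m \<or> i = Suc m \<or> i > Suc m" using that by linarith
      then show ?thesis
        by (elim disjE) (use V in \<open>simp_all add: T_def A_def coeff_sigma_pderiv coeff_eq_0 degP leadP degU leadU b_def
          del: mult_pCons_left\<close>)
    qed
    then show "degree T < Suc m"
      by (rule degree_less_SucI)
    fix q :: "real poly" assume q: "degree q < Suc m"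
    define X where "X = [:0, 1 :: real:]"
    define r where "r = A * pderiv q + B * q + smult k (X * q)"
    have "coeff r (Suc i) = 0" if "i \<ge> m" for i
    proof -
      have "coeff (B * q) (Suc i) = (\<beta> - \<alpha>) * coeff q (Suc i) - (\<alpha> + \<beta> + 2) * coeff q i"
        by (simp add: B_def algebra_simps)
      moreover have "coeff (smult k (X * q)) (Suc i) = k * coeff q i" by (simp add: X_def)
      ultimately have "coeff r (Suc i) = (real m - real i) * coeff q i"
        unfolding r_def A_def coeff_add coeff_sigma_pderiv k_def
        using that q by (simp add: coeff_eq_0 algebra_simps)
      then show ?thesis using that q by (cases "i = m") (auto simp: coeff_eq_0)
    qed
    then have "degree r < Suc m"
      by (rule degree_less_SucI)
    then have "I (P * r) = 0" by (rule orthP)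
    moreover have "I (P * r) = I (P * (A * pderiv q + B * q)) + k * I (X * P * q)"
      by (simp add: r_def distrib_left I_linear mult_ac)
    ultimately have 1: "I (A * pderiv P * q) = k * I (X * P * q)"
      using I_Pearson_mult[of P q] unfolding A_def[symmetric] B_def[symmetric] by linarith
    have V_eq: "V = X * P - smult a P - U" using UV by (simp add: X_def algebra_simps)
    have eq: "V * q = X * P * q - smult a (P * q) - U * q"
      unfolding V_eq by (simp add: algebra_simps)
    have 2: "I (V * q) = I (X * P * q)"
      unfolding eq using q by (simp add: I_linear orthP orthU)
    have "I (T * q) = I (A * pderiv P * q) + (real m + 1) * I (U * q) - b * I (P * q) - k * I (V * q)"
      by (simp add: T_def I_linear algebra_simps)
    then show "I (T * q) = 0" using q by (simp add: 1 2 orthP orthU)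
  qed
  then show ?thesis by (simp add: T_def A_def b_def k_def algebra_simps del: mult_pCons_left)
qed

text \<open>
  At \<open>x = 1\<close> the factor \<open>1 - x^2\<close> vanishes, so the recurrence and the structure relation are two
  linear equations for \<open>U(1)\<close> and \<open>V(1)\<close>. The subleading coefficients are known only after
  multiplication by \<open>2 n + \<alpha> + \<beta>\<close> and \<open>2 n + \<alpha> + \<beta> + 2\<close>; keeping these factors avoids divisions.
\<close>

lemma values_at_one:
  assumes P: "monic_orthogonal (Suc m) P" and U: "monic_orthogonal (Suc (Suc m)) U"
    and UV: "U + V = [:-a, 1:] * P" and V: "degree V \<le> m"
  defines "n \<equiv> real m + 1"
  shows "(2 * n + \<alpha> + \<beta> + 1) * ((2 * n + \<alpha> + \<beta>) * poly V 1) = 2 * n * (n + \<beta>) * poly P 1"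
    and "(2 * n + \<alpha> + \<beta> + 1) * ((2 * n + \<alpha> + \<beta> + 2) * poly U 1)
         = 2 * (n + \<alpha> + \<beta> + 1) * (n + \<alpha> + 1) * poly P 1"
proof -
  define s p p' where "s = \<alpha> + \<beta>" and "p = coeff P m" and "p' = coeff U (Suc m)"
  define R u v where "R = poly P 1" and "u = poly U 1" and "v = poly V 1"
  have p: "(2 * n + s) * p = n * (\<alpha> - \<beta>)"
    using monic_orthogonal_subleading[OF P] by (simp add: n_def s_def p_def algebra_simps)
  have p': "(2 * n + s + 2) * p' = (n + 1) * (\<alpha> - \<beta>)"
    using monic_orthogonal_subleading[OF U] by (simp add: n_def s_def p'_def algebra_simps)
  have "coeff (U + V) (Suc m) = coeff ([:-a, 1:] * P) (Suc m)" using UV by simp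
  then have a: "a = p - p'"
    using P V by (auto simp: monic_orthogonal_def coeff_eq_0 p_def p'_def)
  have "poly (U + V) 1 = poly ([:-a, 1:] * P) 1" using UV by simp
  then have 1: "u + v = (1 - a) * R" by (simp add: u_def v_def R_def algebra_simps)
  from arg_cong[OF structure_relation[OF P U UV V], of "\<lambda>q. poly q 1"]
  have 2: "n * u = (n * p' - (n - 1) * p) * R + (n + s + 1) * v"
    by (simp add: u_def v_def R_def n_def p_def p'_def s_def algebra_simps)
  have "(2 * n + s + 1) * v = (n - p) * R" using 1 2 unfolding a by algebra
  then have "(2 * n + s + 1) * ((2 * n + s) * v) = (2 * n + s) * (n - p) * R" by algebra
  also have "(2 * n + s) * (n - p) = 2 * n * (n + \<beta>)" using p unfolding s_def by algebra
  finally show "(2 * n + \<alpha> + \<beta> + 1) * ((2 * n + \<alpha> + \<beta>) * poly V 1) = 2 * n * (n + \<beta>) * poly P 1"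
    by (simp add: s_def v_def R_def add.assoc)
  have "(2 * n + s + 1) * u = ((n + s + 1) - (2 * n + s) * p + (2 * n + s + 1) * p') * R"
    using 1 2 unfolding a by algebra
  then have "(2 * n + s + 1) * ((2 * n + s + 2) * u)
      = (2 * n + s + 2) * ((n + s + 1) - (2 * n + s) * p + (2 * n + s + 1) * p') * R" by algebra
  also have "(2 * n + s + 2) * ((n + s + 1) - (2 * n + s) * p + (2 * n + s + 1) * p')
      = 2 * (n + s + 1) * (n + \<alpha> + 1)" using p p' unfolding s_def by algebra
  finally show "(2 * n + \<alpha> + \<beta> + 1) * ((2 * n + \<alpha> + \<beta> + 2) * poly U 1)
         = 2 * (n + \<alpha> + \<beta> + 1) * (n + \<alpha> + 1) * poly P 1"
    by (simp add: s_def u_def R_def add.assoc)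
qed

end

section \<open>Nodal polynomials\<close>

definition nodal_poly :: "nat set \<Rightarrow> (nat \<Rightarrow> real) \<Rightarrow> real poly" where
  "nodal_poly K x = (\<Prod>k\<in>K. [:- x k, 1:])"

lemma degree_nodal_poly: "degree (nodal_poly K x) = card K"
  unfolding nodal_poly_def by (subst degree_prod_eq_sum_degree) auto

lemma lead_coeff_nodal_poly: "lead_coeff (nodal_poly K x) = 1"
  unfolding nodal_poly_def lead_coeff_prod by simp

lemma coeff_nodal_poly: "card K = m \<Longrightarrow> coeff (nodal_poly K x) m = 1"
  using lead_coeff_nodal_poly[of K x] by (simp add: degree_nodal_poly)

lemma nodal_poly_nonzero: "nodal_poly K x \<noteq> 0"
  using lead_coeff_nodal_poly[of K x] by auto

lemma poly_nodal_poly: "poly (nodal_poly K x) t = (\<Prod>k\<in>K. t - x k)"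
  by (simp add: nodal_poly_def poly_prod)

lemma nodal_poly_remove:
  "finite K \<Longrightarrow> k \<in> K \<Longrightarrow> nodal_poly K x = [:- x k, 1:] * nodal_poly (K - {k}) x"
  unfolding nodal_poly_def by (rule prod.remove)

lemma poly_nodal_poly_zero: "finite K \<Longrightarrow> k \<in> K \<Longrightarrow> poly (nodal_poly K x) (x k) = 0"
  by (auto simp: poly_nodal_poly)

lemma quad_rule_nodal_poly: "quad_rule m c x (poly (nodal_poly {1..m} x * q)) = 0"
  by (auto simp: quad_rule_def poly_nodal_poly_zero)

lemma degree_monic_diff_less:
  fixes p q :: "real poly"
  assumes "degree p = m" "degree q = m" "lead_coeff p = 1" "lead_coeff q = 1" "m > 0"
  shows "degree (p - q) < m"
proof (rule degree_lessI)
  have "coeff (p - q) i = 0" if "i \<ge> m" for i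
    using assms that by (cases "i = m") (auto simp: coeff_eq_0)
  then show "\<forall>i\<ge>m. coeff (p - q) i = 0" by blast
qed (use assms in simp)

section \<open>Location of the anti-Gaussian nodes\<close>

locale jacobi_rules = jacobi_functional +
  fixes \<theta> :: real and n :: nat and \<mu> x c \<xi> :: "nat \<Rightarrow> real"
  assumes n: "n \<ge> 1" and theta: "\<theta> > 0"
    and mono: "strict_mono_on {1..n+1} \<xi>"
    and gauss: "degree p < 2 * n \<Longrightarrow> quad_rule n \<mu> x (poly p) = I p"
    and anti_gauss: "degree p \<le> 2 * n + 1 \<Longrightarrow>
          quad_rule (n + 1) c \<xi> (poly p) = (1 + \<theta>) * I p - \<theta> * quad_rule n \<mu> x (poly p)"
begin

definition P :: "real poly" where "P = nodal_poly {1..n} x"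
definition W :: "real poly" where "W = nodal_poly {1..n+1} \<xi>"
definition H :: "real poly \<Rightarrow> real" where "H p = quad_rule (n + 1) c \<xi> (poly p)"

lemma degree_P: "degree P = n" and coeff_P: "coeff P n = 1" and P_nonzero: "P \<noteq> 0"
  and degree_W: "degree W = Suc n" and coeff_W: "coeff W (Suc n) = 1"
  by (simp_all add: P_def W_def degree_nodal_poly coeff_nodal_poly nodal_poly_nonzero)

lemma quad_rule_P: "quad_rule n \<mu> x (poly (P * q)) = 0" and H_W: "H (W * q) = 0"
  unfolding H_def P_def W_def by (rule quad_rule_nodal_poly)+

lemma gauss_nodal_orthogonal: "monic_orthogonal n P"
  unfolding monic_orthogonal_def
proof (intro conjI allI impI)
  fix q :: "real poly" assume "degree q < n"
  then have "degree (P * q) < 2 * n"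
    using degree_mult_le[of P q] by (simp add: degree_P)
  then show "I (P * q) = 0"
    using gauss[of "P * q"] by (simp only: quad_rule_P)
qed (auto simp: degree_P coeff_P)

lemma gauss_orthogonal: "degree q < n \<Longrightarrow> I (P * q) = 0"
  using gauss_nodal_orthogonal by (simp add: monic_orthogonal_def)

text \<open>
  If \<open>x k \<ge> 1\<close>, then \<open>(x k - t) r(t)^2\<close>, with \<open>r\<close> the nodal polynomial of the other nodes, would be
  nonnegative on the interval and yet have integral zero.
\<close>

lemma gauss_node_less_1:
  assumes k: "k \<in> {1..n}"
  shows "x k < 1"
proof (rule ccontr)
  assume "\<not> x k < 1"
  define r where "r = nodal_poly ({1..n} - {k}) x"
  have P: "P = [:- x k, 1:] * r" unfolding r_def P_def using k by (intro nodal_poly_remove) auto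
  have "degree r < n" using k by (simp add: r_def degree_nodal_poly)
  then have "I (P * r) = 0" by (rule gauss_orthogonal)
  moreover have "[:x k, -1:] * (r * r) = - (P * r)"
    unfolding P by (simp add: algebra_simps)
  moreover have "I ([:x k, -1:] * (r * r)) > 0"
  proof (rule I_positive)
    show "[:x k, -1:] * (r * r) \<noteq> 0" by (simp add: r_def nodal_poly_nonzero del: mult_pCons_left)
    show "poly ([:x k, -1:] * (r * r)) t \<ge> 0" if "t \<le> 1" for t
      using that \<open>\<not> x k < 1\<close> by (simp del: mult_pCons_left)
  qed
  ultimately show False by (simp add: I_minus)
qed

lemma gauss_nodal_pos_right: "t \<ge> 1 \<Longrightarrow> poly P t > 0"
  using gauss_node_less_1 by (fastforce simp: P_def poly_nodal_poly intro!: prod_pos)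

lemma H_gauss_nodal:
  assumes "degree q \<le> n + 1"
  shows "H (P * q) = (1 + \<theta>) * I (P * q)"
proof -
  have "degree (P * q) \<le> 2 * n + 1"
    using degree_mult_le[of P q] assms by (simp add: degree_P)
  then show ?thesis using anti_gauss[of "P * q"] unfolding quad_rule_P H_def by simp
qed

lemma H_low_degree: "degree p < 2 * n \<Longrightarrow> H p = I p"
  using anti_gauss[of p] gauss[of p] by (simp add: H_def algebra_simps)

lemma H_add: "H (p + q) = H p + H q" and H_diff: "H (p - q) = H p - H q"
  and H_smult: "H (smult a p) = a * H p"
  by (auto simp: H_def quad_rule_def sum.distrib sum_subtractf sum_distrib_left algebra_simps)

text \<open>
  In \<open>p = P + g\<close> the part \<open>P\<close> contributes \<open>(1 + \<theta>) I (P * P)\<close> and the part \<open>g\<close>, of lower degree,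
  contributes \<open>I (g * g)\<close>, while the mixed terms vanish.
\<close>

lemma H_monic_square_pos:
  assumes "degree p = n" and "lead_coeff p = 1"
  shows "H (p * p) > 0"
proof -
  define g where "g = p - P"
  have g: "degree g < n"
    unfolding g_def using assms n
    by (intro degree_monic_diff_less) (auto simp: degree_P coeff_P)
  have eq: "p * p = P * P + P * g + P * g + g * g" by (simp add: g_def algebra_simps)
  have "degree (g * g) < 2 * n" using degree_mult_le[of g g] g by linarith
  then have "H (p * p) = (1 + \<theta>) * I (P * P) + I (g * g)"
    unfolding eq H_add using g by (simp add: H_gauss_nodal H_low_degree gauss_orthogonal degree_P)
  moreover have "I (P * P) > 0" by (rule I_square_pos) (rule P_nonzero)
  moreover have "I (g * g) \<ge> 0"
    using I_square_pos[of g] by (cases "g = 0") (auto simp: I_zero)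
  ultimately show ?thesis using theta by (simp add: add_pos_nonneg)
qed

text \<open>
  The square of the nodal polynomial of the other nodes isolates \<open>c k\<close>. Its degree \<open>2 n\<close> is one too
  high for \<open>H\<close> to agree with \<open>I\<close>, so positivity of \<open>I\<close> does not apply directly.
\<close>

lemma anti_gauss_weight_pos:
  assumes k: "k \<in> {1..n+1}"
  shows "c k > 0"
proof -
  define r where "r = nodal_poly ({1..n+1} - {k}) \<xi>"
  have "H (r * r) > 0"
    using k by (intro H_monic_square_pos) (auto simp: r_def degree_nodal_poly coeff_nodal_poly)
  also have "H (r * r) = (\<Sum>i\<in>{k}. c i * poly (r * r) (\<xi> i))"
    unfolding H_def quad_rule_def using k
    by (intro sum.mono_neutral_right) (auto simp: r_def poly_nodal_poly_zero)
  finally have "0 < c k * (poly r (\<xi> k))\<^sup>2" by (simp add: power2_eq_square)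
  then show ?thesis by (simp add: zero_less_mult_iff)
qed

text \<open>
  The rule integrates \<open>P * r\<close> to zero when \<open>r\<close> has the \<open>n - 1\<close> smallest nodes as its roots. Only
  the two largest nodes contribute, and if both were at least \<open>1\<close>, their contributions would be
  positive.
\<close>

lemma second_largest_node_less_1: "\<xi> n < 1"
proof (rule ccontr)
  assume "\<not> \<xi> n < 1"
  define r where "r = nodal_poly {1..<n} \<xi>"
  have less: "\<xi> i < \<xi> j" if "1 \<le> i" "i < j" "j \<le> n + 1" for i j
    using strict_mono_onD[OF mono, of i j] that by auto
  have pos: "c i * (poly P (\<xi> i) * poly r (\<xi> i)) > 0" if "i \<in> {n, n + 1}" for i
  proof -
    have "\<xi> i \<ge> 1" using that less[of n "n + 1"] n \<open>\<not> \<xi> n < 1\<close> by auto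
    then have "poly P (\<xi> i) > 0" by (rule gauss_nodal_pos_right)
    moreover have "poly r (\<xi> i) > 0"
      unfolding r_def poly_nodal_poly using less that by (intro prod_pos) auto
    ultimately show ?thesis using anti_gauss_weight_pos[of i] that n by auto
  qed
  have "degree r < n" using n by (simp add: r_def degree_nodal_poly)
  then have "H (P * r) = 0" by (simp add: H_gauss_nodal gauss_orthogonal)
  moreover have "H (P * r) = (\<Sum>i\<in>{n, n + 1}. c i * poly (P * r) (\<xi> i))"
    unfolding H_def quad_rule_def using n
    by (intro sum.mono_neutral_right) (auto simp: r_def poly_nodal_poly_zero)
  ultimately show False using pos[of n] pos[of "n + 1"] by simp
qed

lemma nodes_le_1_iff: "(\<forall>k\<in>{1..n+1}. \<xi> k \<le> 1) \<longleftrightarrow> poly W 1 \<ge> 0"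
proof
  assume "\<forall>k\<in>{1..n+1}. \<xi> k \<le> 1"
  then show "poly W 1 \<ge> 0" unfolding W_def poly_nodal_poly by (intro prod_nonneg) auto
next
  assume W: "poly W 1 \<ge> 0"
  have le: "\<xi> k \<le> \<xi> n" if "k \<in> {1..n}" for k
    using strict_mono_onD[OF mono, of k n] that by (cases "k = n") auto
  then have less: "\<xi> k < 1" if "k \<in> {1..n}" for k
    using that second_largest_node_less_1 by fastforce
  then have "(\<Prod>k\<in>{1..n}. 1 - \<xi> k) > 0" by (intro prod_pos) auto
  moreover have "poly W 1 = (1 - \<xi> (n + 1)) * (\<Prod>k\<in>{1..n}. 1 - \<xi> k)"
    unfolding W_def poly_nodal_poly by (simp add: mult.commute)
  ultimately have "\<xi> (n + 1) \<le> 1" using W by (simp add: zero_le_mult_iff)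
  with less show "\<forall>k\<in>{1..n+1}. \<xi> k \<le> 1" by (metis add.commute atLeastAtMost_iff le_Suc_eq less_imp_le plus_1_eq_Suc)
qed

text \<open>
  The number \<open>a\<close> is determined by \<open>degree V < n\<close>. For \<open>q\<close> of degree at most \<open>n\<close>, the rule multiplies
  the integral of \<open>(x - a) P q\<close> by \<open>1 + \<theta>\<close> and leaves that of \<open>V q\<close> unchanged. The factor
  \<open>1 + \<theta>\<close> in front of \<open>V\<close> in \<open>W = (x - a) P - (1 + \<theta>) V\<close> compensates this, so that \<open>H (W q) = 0\<close>
  amounts to the orthogonality of \<open>U = (x - a) P - V\<close> to \<open>q\<close>.
\<close>

lemma modified_nodal_decomposition:
  obtains a U V where "monic_orthogonal (Suc n) U" and "degree V < n"
    and "U + V = [:- a, 1:] * P" and "W = U - smult \<theta> V"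
proof -
  define a where "a = coeff P (n - 1) - coeff W n"
  define V where "V = smult (1 / (1 + \<theta>)) ([:- a, 1:] * P - W)"
  define U where "U = [:- a, 1:] * P - V"
  have "coeff ([:- a, 1:] * P - W) i = 0" if i_ge: "i \<ge> n" for i
  proof -
    obtain j where i: "i = Suc j" using i_ge n by (cases i) auto
    have "coeff ([:- a, 1:] * P - W) i = coeff P j - a * coeff P (Suc j) - coeff W (Suc j)"
      by (simp add: i)
    moreover have "n = Suc j \<or> n = j \<or> n < j" using i_ge i by linarith
    ultimately show ?thesis
      using coeff_P coeff_W degree_P degree_W by (elim disjE) (simp_all add: a_def coeff_eq_0)
  qed
  then have V: "degree V < n"
    unfolding V_def using n by (intro degree_lessI) auto
  have W: "W = [:- a, 1:] * P - smult (1 + \<theta>) V"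
    using theta by (simp add: V_def)
  have orth: "I (U * q) = 0" if q: "degree q < Suc n" for q
  proof -
    have W0: "H (W * q) = 0" by (rule H_W)
    have eq: "W * q = P * ([:- a, 1:] * q) - smult (1 + \<theta>) (V * q)"
      unfolding W by (simp add: algebra_simps)
    have "degree ([:- a, 1:] * q) \<le> n + 1"
      using degree_mult_le[of "[:- a, 1:]" q] q by simp
    moreover have "degree (V * q) < 2 * n" using degree_mult_le[of V q] V q by linarith
    ultimately have "0 = (1 + \<theta>) * (I (P * ([:- a, 1:] * q)) - I (V * q))"
      using W0 unfolding eq H_diff H_smult 
      by (simp add: H_gauss_nodal H_low_degree right_diff_distrib del: mult_pCons_left)
    moreover have "U * q = P * ([:- a, 1:] * q) - V * q" by (simp add: U_def algebra_simps)
    ultimately show ?thesis using theta by (simp add: I_diff)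
  qed
  have UW: "U = W + smult \<theta> V" unfolding U_def W by (simp add: smult_add_left)
  have "coeff U (Suc n) = 1"
    unfolding UW using V by (simp add: coeff_W coeff_eq_0)
  moreover have "degree U = Suc n"
    unfolding UW using V degree_smult_le[of \<theta> V] by (subst degree_add_eq_left) (auto simp: degree_W)
  ultimately have "monic_orthogonal (Suc n) U" by (simp add: monic_orthogonal_def orth)
  then show ?thesis using V by (rule that[of U V a]) (simp_all add: UW, simp add: U_def UW[symmetric])
qed

lemma nodes_le_1_iff_h_bound: "(\<forall>k\<in>{1..n+1}. \<xi> k \<le> 1) \<longleftrightarrow> \<theta> \<le> h_bound n \<alpha> \<beta>"
proof -
  obtain a U V where U: "monic_orthogonal (Suc n) U" and V: "degree V < n"
    and UV: "U + V = [:- a, 1:] * P" and W: "W = U - smult \<theta> V"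
    by (rule modified_nodal_decomposition)
  obtain m where m: "n = Suc m" using n by (cases n) auto
  define N s R where "N = real n" and "s = \<alpha> + \<beta>" and "R = poly P 1"
  have N: "N \<ge> 1" and s: "s > -2" using n alpha beta by (auto simp: N_def s_def)
  have "R > 0" unfolding R_def by (rule gauss_nodal_pos_right) simp
  have nm: "real m + 1 = N" by (simp add: N_def m)
  have "monic_orthogonal (Suc m) P" "monic_orthogonal (Suc (Suc m)) U" "degree V \<le> m"
    using gauss_nodal_orthogonal U V by (simp_all add: m)
  from values_at_one[OF this(1,2) UV this(3)]
  have v: "(2 * N + s + 1) * ((2 * N + s) * poly V 1) = 2 * N * (N + \<beta>) * R"
    and u: "(2 * N + s + 1) * ((2 * N + s + 2) * poly U 1) = 2 * (N + s + 1) * (N + \<alpha> + 1) * R"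
    unfolding nm by (simp_all add: s_def R_def add.assoc)
  have pos: "2 * N + s + 1 > 0" "2 * N + s > 0" "2 * N + s + 2 > 0" "N + \<beta> > 0" "N + s / 2 + 1 > 0"
    using N s beta by auto
  have divide: "y = r / (A * C)" if "A * (C * y) = r" "A > 0" "C > 0" for y r A C :: real
    using that by (simp add: field_simps)
  have v': "poly V 1 = 2 * N * (N + \<beta>) * R / ((2 * N + s + 1) * (2 * N + s))"
    and u': "poly U 1 = 2 * (N + s + 1) * (N + \<alpha> + 1) * R / ((2 * N + s + 1) * (2 * N + s + 2))"
    by (intro divide u v pos)+
  have V1: "poly V 1 > 0" unfolding v' using N pos \<open>R > 0\<close> by simp
  have h: "h_bound n \<alpha> \<beta> = (N + s + 1) * (N + \<alpha> + 1) * (2 * N + s) / (N * (N + \<beta>) * (2 * N + s + 2))"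
  proof -
    define D where "D = N * (N + \<beta>) * (N + s / 2 + 1)"
    have D: "D > 0" using N pos by (simp add: D_def)
    have "h_bound n \<alpha> \<beta> = 1 + ((2 * \<alpha> + 1) * N * (N + s + 1) + 1 / 2 * (\<alpha> + 1) * s * (s + 1)) / D"
      by (simp add: h_bound_def N_def D_def s_def add.assoc)
    also have "\<dots> = (D + (2 * \<alpha> + 1) * N * (N + s + 1) + 1 / 2 * (\<alpha> + 1) * s * (s + 1)) / D"
      using D by (simp add: add_divide_distrib)
    also have "D + (2 * \<alpha> + 1) * N * (N + s + 1) + 1 / 2 * (\<alpha> + 1) * s * (s + 1)
        = (N + s + 1) * (N + \<alpha> + 1) * (2 * N + s) / 2"
      unfolding D_def s_def by (simp add: field_simps)
    also have "D = N * (N + \<beta>) * (2 * N + s + 2) / 2" by (simp add: D_def field_simps)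
    finally show ?thesis by simp
  qed
  have "poly U 1 = h_bound n \<alpha> \<beta> * poly V 1"
  proof -
    have "2 * (N + s + 1) * (N + \<alpha> + 1) * R / (A * B) =
        (N + s + 1) * (N + \<alpha> + 1) * C / (N * (N + \<beta>) * B) * (2 * N * (N + \<beta>) * R / (A * C))"
      if "A > 0" "B > 0" "C > 0" for A B C :: real
      using that N pos(4) by (simp add: divide_simps)
    then show ?thesis unfolding h u' v' using pos by blast
  qed
  then have "poly W 1 = (h_bound n \<alpha> \<beta> - \<theta>) * poly V 1"
    by (simp add: W left_diff_distrib)
  then show ?thesis
    unfolding nodes_le_1_iff using V1 by (simp add: zero_le_mult_iff)
qed

end

section \<open>Reflection and the theorem\<close>

text \<open>
  Besides changing the sign of the nodes, reflection reverses their numbering, to keep them in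
  increasing order.
\<close>

lemma quad_rule_reflect:
  "quad_rule m (\<lambda>k. c (m + 1 - k)) (\<lambda>k. - x (m + 1 - k)) f = quad_rule m c x (\<lambda>t. f (- t))"
  unfolding quad_rule_def by (subst (2) sum.atLeastAtMost_rev) simp

lemma strict_mono_on_reflect:
  fixes x :: "nat \<Rightarrow> real"
  assumes "strict_mono_on {1..m} x"
  shows "strict_mono_on {1..m} (\<lambda>k. - x (m + 1 - k))"
proof (rule strict_mono_onI)
  fix i j assume "i \<in> {1..m}" "j \<in> {1..m}" "i < j"
  then show "- x (m + 1 - i) < - x (m + 1 - j)"
    using strict_mono_onD[OF assms, of "m + 1 - j" "m + 1 - i"] by auto
qed

lemma poly_reflect: "(\<lambda>t. poly p (- t)) = poly (pcompose p [:0, -1 :: real:])"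
  by (auto simp: poly_pcompose)

lemma jacobi_integral_poly_reflect:
  "jacobi_integral \<alpha> \<beta> (poly (pcompose p [:0, -1:])) = jacobi_integral \<beta> \<alpha> (poly p)"
  by (simp only: poly_reflect[symmetric] jacobi_integral_reflect)

lemma is_gauss_rule_reflect:
  assumes "is_gauss_rule (jacobi_integral \<alpha> \<beta>) m \<mu> x"
  shows "is_gauss_rule (jacobi_integral \<beta> \<alpha>) m (\<lambda>k. \<mu> (m + 1 - k)) (\<lambda>k. - x (m + 1 - k))"
  using assms
  unfolding is_gauss_rule_def quad_rule_reflect
  by (auto simp: poly_reflect degree_pcompose jacobi_integral_poly_reflect intro: strict_mono_on_reflect[simplified])

lemma is_modified_anti_gauss_rule_reflect:
  assumes "is_modified_anti_gauss_rule (jacobi_integral \<alpha> \<beta>) (quad_rule m \<mu> x) \<theta> n c \<xi>"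
  shows "is_modified_anti_gauss_rule (jacobi_integral \<beta> \<alpha>)
           (quad_rule m (\<lambda>k. \<mu> (m + 1 - k)) (\<lambda>k. - x (m + 1 - k))) \<theta> n
           (\<lambda>k. c (n + 1 + 1 - k)) (\<lambda>k. - \<xi> (n + 1 + 1 - k))"
  using assms
  unfolding is_modified_anti_gauss_rule_def quad_rule_reflect
  by (auto simp: poly_reflect degree_pcompose jacobi_integral_poly_reflect simp del: add_Suc_right add_2_eq_Suc'
      intro: strict_mono_on_reflect[of "n + 1" \<xi>, simplified])

lemma anti_gauss_nodes_le_1_iff:
  assumes "\<alpha> > -1" and "\<beta> > -1" and "n \<ge> 1" and "\<theta> > 0"
    and "is_gauss_rule (jacobi_integral \<alpha> \<beta>) n \<mu> x"
    and "is_modified_anti_gauss_rule (jacobi_integral \<alpha> \<beta>) (quad_rule n \<mu> x) \<theta> n c \<xi>"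
  shows "(\<forall>k\<in>{1..n+1}. \<xi> k \<le> 1) \<longleftrightarrow> \<theta> \<le> h_bound n \<alpha> \<beta>"
proof -
  note int = poly_jacobi_weight_integrable[OF assms(1,2)]
  interpret jacobi_rules "\<lambda>p. jacobi_integral \<alpha> \<beta> (poly p)" \<alpha> \<beta> \<theta> n \<mu> x c \<xi>
  proof unfold_locales
    fix p q :: "real poly" and a :: real
    show "jacobi_integral \<alpha> \<beta> (poly (p + q)) = jacobi_integral \<alpha> \<beta> (poly p) + jacobi_integral \<alpha> \<beta> (poly q)"
      using integral_add[OF int[of p] int[of q]] by (simp add: jacobi_integral_def distrib_right)
    show "jacobi_integral \<alpha> \<beta> (poly (smult a p)) = a * jacobi_integral \<alpha> \<beta> (poly p)"
      by (simp add: jacobi_integral_def mult.assoc)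
    show "jacobi_integral \<alpha> \<beta> (poly ([:1, 0, -1:] * pderiv p + [:\<beta> - \<alpha>, -(\<alpha> + \<beta> + 2):] * p)) = 0"
      using assms by (intro jacobi_integral_Pearson)
  qed (use assms jacobi_integral_positive in
        \<open>auto simp: is_gauss_rule_def is_modified_anti_gauss_rule_def simp del: One_nat_def\<close>)
  show ?thesis by (rule nodes_le_1_iff_h_bound)
qed

theorem mainTheorem1:
  fixes \<alpha> \<beta> \<theta> :: real and n :: nat
    and \<mu> x :: "nat \<Rightarrow> real" \<comment> \<open>weights and nodes of the Gaussian rule\<close>
    and c \<xi> :: "nat \<Rightarrow> real" \<comment> \<open>weights and nodes of the modified anti-Gaussian rule\<close>
  assumes "\<alpha> > -1" and "\<beta> > -1" and "n \<ge> 1" and "\<theta> > 0"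
    and "is_gauss_rule (jacobi_integral \<alpha> \<beta>) n \<mu> x"
    and "is_modified_anti_gauss_rule (jacobi_integral \<alpha> \<beta>) (quad_rule n \<mu> x) \<theta> n c \<xi>"
  shows "internal_rule (n + 1) \<xi> \<longleftrightarrow> \<theta> \<le> theta_max n \<alpha> \<beta>"
proof -
  have right: "(\<forall>k\<in>{1..n+1}. \<xi> k \<le> 1) \<longleftrightarrow> \<theta> \<le> h_bound n \<alpha> \<beta>"
    using assms by (rule anti_gauss_nodes_le_1_iff)
  have "(\<forall>k\<in>{1..n+1}. - \<xi> (n + 1 + 1 - k) \<le> 1) \<longleftrightarrow> \<theta> \<le> h_bound n \<beta> \<alpha>"
    using assms(2,1,3,4) is_gauss_rule_reflect[OF assms(5)]
      is_modified_anti_gauss_rule_reflect[OF assms(6)]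
    by (rule anti_gauss_nodes_le_1_iff)
  moreover have "(\<forall>k\<in>{1..n+1}. - \<xi> (n + 1 + 1 - k) \<le> 1) \<longleftrightarrow> (\<forall>k\<in>{1..n+1}. -1 \<le> \<xi> k)"
  proof -
    have "(\<lambda>k. n + 1 + 1 - k) ` {1..n+1} = {1..n+1}"
      by (auto intro!: image_eqI[of k _ "n + 1 + 1 - k" for k])
    then have "(\<forall>k\<in>{1..n+1}. -1 \<le> \<xi> k) \<longleftrightarrow> (\<forall>k\<in>{1..n+1}. -1 \<le> \<xi> (n + 1 + 1 - k))"
      by (metis (no_types, lifting) image_iff)
    then show ?thesis by (simp add: minus_le_iff)
  qed
  ultimately show ?thesis
    using right unfolding internal_rule_def theta_max_def by auto
qed

end
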